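(* Let $X$ be any unital topologized magma. Then the semidirect product $\mathrm{HM}_0(X)\rtimes_{\alpha_X}\mathbb Z$ is a duoseparable unital topologized magma which contains an isomorphic copy of $X$ (i.e., a submagma that, with the subspace topology, is topologically isomorphic to $X$).
   Context: A magma is a set $X$ with a binary operation $(x,y)\mapsto x\cdot y=xy$. It is unital if there is a (necessarily unique) element $1_X\in X$ with $1_X\cdot x=x\cdot 1_X=x$ for all $x\in X$. A topologized magma is a topological space endowed with a binary operation; no continuity of the operation is required. A continuous homomorphism of unital topologized magmas is a continuous map $f$ with $f(1_X)=1_Y$ and $f(xy)=f(x)f(y)$ for all $x,y$. An automorphism is a bijective self-map $\alpha$ such that $\alpha$ and $\alpha^{-1}$ are continuous homomorphisms. A topological isomorphism is a bijection that is a continuous homomorphism with continuous inverse. For $A,B\subseteq X$ put $AB=\{ab:a\in A,\ b\in B\}$. A unital topologized magma $X$ is duoseparable if there is a countable subset $S\subseteq X$ such that $S(US)=X=(SU)S$ for every neighborhood $U\subseteq X$ of the unit. Hartman–Mycielski construction: for a topological space $X$, $\mathrm{HM}(X)$ is the set of all functions $f:[0,1)\to X$ for which there is a sequence $0=a_0<a_1<\dots<a_n=1$ such that $f$ is constant on $[a_i,a_{i+1})$ for every $i<n$. It carries the topology generated by the subbase of sets $N(U,a,b;\varepsilon)=\{f\in \mathrm{HM}(X):\lambda([a,b)\setminus f^{-1}(U))<\varepsilon\}$, where $U\subseteq X$ is open, $0\le a<b\le 1$, $\varepsilon>0$, and $\lambda$ is Lebesgue measure on $[0,1)$. If $X$ is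 a unital topologized magma, $\mathrm{HM}(X)$ has the pointwise operation $(fg)(t)=f(t)\cdot g(t)$, with unit the constant function $1_X$. Then $\mathrm{HM}_0(X)=\{f\in \mathrm{HM}(X): f(0)=1_X\}$, with the subspace topology and the induced operation. The automorphism $\alpha_X:\mathrm{HM}_0(X)\to \mathrm{HM}_0(X)$ is $\alpha_X(\gamma)=\gamma\circ s$, where $s:[0,1)\to[0,1)$, $s(t)=t^2$. For an automorphism $\alpha$ of a topologized magma $Y$, the semidirect product $Y\rtimes_\alpha\mathbb Z$ is the product space $Y\times\mathbb Z$ ($\mathbb Z$ the discrete additive group of integers) with the operation $(x,n)*(y,m)=(x\cdot\alpha^n(y),\,n+m)$. *)

theory Defs
  imports "HOL-Analysis.Analysis"
begin

section \<open>Topologized magmas\<close>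

text \<open>The carrier is the underlying set of the topology.
  The operation need not be continuous.\<close>

record 'a topmagma =
  topo :: "'a topology"
  mul :: "'a \<Rightarrow> 'a \<Rightarrow> 'a"

abbreviation carr :: "'a topmagma \<Rightarrow> 'a set" where
  "carr X \<equiv> topspace (topo X)"

definition topologized_magma :: "'a topmagma \<Rightarrow> bool" where
  "topologized_magma X \<longleftrightarrow> (\<forall>x\<in>carr X. \<forall>y\<in>carr X. mul X x y \<in> carr X)"

definition is_unit_of :: "'a topmagma \<Rightarrow> 'a \<Rightarrow> bool" where
  "is_unit_of X e \<longleftrightarrow> e \<in> carr X \<and> (\<forall>x\<in>carr X. mul X e x = x \<and> mul X x e = x)"

definition unital_topologized_magma :: "'a topmagma \<Rightarrow> bool" where
  "unital_topologized_magma X \<longleftrightarrow> topologized_magma X \<and> (\<exists>e. is_unit_of X e)"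

definition magma_unit :: "'a topmagma \<Rightarrow> 'a" where
  "magma_unit X = (THE e. is_unit_of X e)"

lemma magma_unit_eqI:
  assumes "is_unit_of X e"
  shows "magma_unit X = e"
  unfolding magma_unit_def
proof (rule the_equality)
  fix e' assume "is_unit_of X e'"
  with assms show "e' = e"
    unfolding is_unit_of_def by metis
qed (rule assms)

lemma is_unit_of_magma_unit: "unital_topologized_magma X \<Longrightarrow> is_unit_of X (magma_unit X)"
  using magma_unit_eqI unital_topologized_magma_def by metis

definition continuous_hom :: "'a topmagma \<Rightarrow> 'b topmagma \<Rightarrow> ('a \<Rightarrow> 'b) \<Rightarrow> bool" where
  "continuous_hom X Y f \<longleftrightarrow>
     continuous_map (topo X) (topo Y) f \<and>
     f (magma_unit X) = magma_unit Y \<and>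
     (\<forall>x\<in>carr X. \<forall>y\<in>carr X. f (mul X x y) = mul Y (f x) (f y))"

definition topological_isomorphism :: "'a topmagma \<Rightarrow> 'b topmagma \<Rightarrow> ('a \<Rightarrow> 'b) \<Rightarrow> bool" where
  "topological_isomorphism X Y f \<longleftrightarrow>
     bij_betw f (carr X) (carr Y) \<and> continuous_hom X Y f \<and>
     continuous_map (topo Y) (topo X) (inv_into (carr X) f)"

definition automorphism :: "'a topmagma \<Rightarrow> ('a \<Rightarrow> 'a) \<Rightarrow> bool" where
  "automorphism X \<alpha> \<longleftrightarrow>
     bij_betw \<alpha> (carr X) (carr X) \<and> continuous_hom X X \<alpha> \<and>
     continuous_hom X X (inv_into (carr X) \<alpha>)"

definition submagma :: "'a set \<Rightarrow> 'a topmagma \<Rightarrow> bool" where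
  "submagma A X \<longleftrightarrow> A \<subseteq> carr X \<and> (\<forall>x\<in>A. \<forall>y\<in>A. mul X x y \<in> A)"

definition restrict_magma :: "'a topmagma \<Rightarrow> 'a set \<Rightarrow> 'a topmagma" where
  "restrict_magma X A = \<lparr>topo = subtopology (topo X) A, mul = mul X\<rparr>"

definition contains_copy_of :: "'b topmagma \<Rightarrow> 'a topmagma \<Rightarrow> bool" where
  "contains_copy_of Y X \<longleftrightarrow>
     (\<exists>A f. submagma A Y \<and> unital_topologized_magma (restrict_magma Y A) \<and>
            topological_isomorphism X (restrict_magma Y A) f)"

definition set_mul :: "'a topmagma \<Rightarrow> 'a set \<Rightarrow> 'a set \<Rightarrow> 'a set" where
  "set_mul X A B = {mul X a b | a b. a \<in> A \<and> b \<in> B}"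

definition neighborhood :: "'a topology \<Rightarrow> 'a \<Rightarrow> 'a set \<Rightarrow> bool" where
  "neighborhood T x U \<longleftrightarrow> U \<subseteq> topspace T \<and> (\<exists>V. openin T V \<and> x \<in> V \<and> V \<subseteq> U)"

definition duoseparable :: "'a topmagma \<Rightarrow> bool" where
  "duoseparable X \<longleftrightarrow>
     unital_topologized_magma X \<and>
     (\<exists>S. S \<subseteq> carr X \<and> countable S \<and>
        (\<forall>U. neighborhood (topo X) (magma_unit X) U \<longrightarrow>
           set_mul X S (set_mul X U S) = carr X \<and>
           set_mul X (set_mul X S U) S = carr X))"


section \<open>The Hartman--Mycielski construction\<close>

text \<open>A function on \<open>[0,1)\<close> is encoded as an extensional function on the reals
  (undefined outside \<open>[0,1)\<close>).\<close>

definition HM_set :: "'a topology \<Rightarrow> (real \<Rightarrow> 'a) set" where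
  "HM_set T = {f \<in> {0..<1} \<rightarrow>\<^sub>E topspace T.
     \<exists>(n::nat) (a::nat \<Rightarrow> real). a 0 = 0 \<and> a n = 1 \<and> (\<forall>i<n. a i < a (Suc i)) \<and>
       (\<forall>i<n. \<exists>c. \<forall>t\<in>{a i..<a (Suc i)}. f t = c)}"

definition HM_nbh :: "'a topology \<Rightarrow> 'a set \<Rightarrow> real \<Rightarrow> real \<Rightarrow> real \<Rightarrow> (real \<Rightarrow> 'a) set" where
  "HM_nbh T U a b \<epsilon> = {f \<in> HM_set T. measure lebesgue ({a..<b} - f -` U) < \<epsilon>}"

definition HM_topology :: "'a topology \<Rightarrow> (real \<Rightarrow> 'a) topology" where
  "HM_topology T = topology_generated_by
     {HM_nbh T U a b \<epsilon> | U a b \<epsilon>. openin T U \<and> 0 \<le> a \<and> a < b \<and> b \<le> 1 \<and> 0 < \<epsilon>}"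

definition HM :: "'a topmagma \<Rightarrow> (real \<Rightarrow> 'a) topmagma" where
  "HM X = \<lparr>topo = HM_topology (topo X),
           mul = (\<lambda>f g. \<lambda>t\<in>{0..<1}. mul X (f t) (g t))\<rparr>"

definition HM0 :: "'a topmagma \<Rightarrow> (real \<Rightarrow> 'a) topmagma" where
  "HM0 X = restrict_magma (HM X) {f \<in> carr (HM X). f 0 = magma_unit X}"

definition HM_shift :: "(real \<Rightarrow> 'a) \<Rightarrow> (real \<Rightarrow> 'a)" where
  "HM_shift \<gamma> = (\<lambda>t\<in>{0..<1}. \<gamma> (t\<^sup>2))"


section \<open>Semidirect products with the integers\<close>

text \<open>\<open>int_power_on C \<alpha> n\<close> is \<open>\<alpha>\<^sup>n\<close> for a bijection \<open>\<alpha>\<close> of \<open>C\<close>. It and \<open>semidirect_int\<close>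
  are total, and meaningful only when \<open>\<alpha>\<close> is an automorphism; for \<open>HM_shift\<close> this is
  \<open>automorphism_HM_shift\<close> below.\<close>

definition int_power_on :: "'a set \<Rightarrow> ('a \<Rightarrow> 'a) \<Rightarrow> int \<Rightarrow> 'a \<Rightarrow> 'a" where
  "int_power_on C \<alpha> n =
     (if 0 \<le> n then \<alpha> ^^ nat n else inv_into C \<alpha> ^^ nat (- n))"

definition semidirect_int :: "'a topmagma \<Rightarrow> ('a \<Rightarrow> 'a) \<Rightarrow> ('a \<times> int) topmagma" where
  "semidirect_int Y \<alpha> =
     \<lparr>topo = prod_topology (topo Y) (discrete_topology UNIV),
      mul = (\<lambda>(x, n) (y, m). (mul Y x (int_power_on (carr Y) \<alpha> n y), n + m))\<rparr>"


section \<open>Squaring the argument is an automorphism of \<open>HM0\<close>\<close>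

lemma topspace_HM_topology [simp]: "topspace (HM_topology T) = HM_set T"
proof -
  have "HM_nbh T (topspace T) 0 1 1 = HM_set T"
  proof -
    have "measure lebesgue ({0..<1} - f -` topspace T) < 1" if "f \<in> HM_set T" for f
    proof -
      have "{0..<1} - f -` topspace T = {}"
        using that by (auto simp: HM_set_def PiE_iff)
      then show ?thesis by (simp only: measure_empty zero_less_one)
    qed
    then show ?thesis by (auto simp: HM_nbh_def)
  qed
  then have "HM_set T \<in> {HM_nbh T U a b \<epsilon> | U a b \<epsilon>.
      openin T U \<and> 0 \<le> a \<and> a < b \<and> b \<le> 1 \<and> 0 < \<epsilon>}"
    by (smt (verit) mem_Collect_eq openin_topspace)
  moreover have "HM_nbh T U a b \<epsilon> \<subseteq> HM_set T" for U a b \<epsilon>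
    by (auto simp: HM_nbh_def)
  ultimately show ?thesis
    unfolding HM_topology_def topology_generated_by_topspace by blast
qed

lemma partition_cell:
  fixes a :: "nat \<Rightarrow> real"
  assumes "a 0 = 0" "a n = 1" "t \<in> {0..<1}"
  obtains i where "i < n" "t \<in> {a i..<a (Suc i)}"
proof -
  have "t < a k \<Longrightarrow> \<exists>i<k. t \<in> {a i..<a (Suc i)}" for k
  proof (induction k)
    case (Suc k)
    then show ?case
      by (cases "t < a k") (auto intro: less_SucI)
  qed (use assms in auto)
  from this[of n] show ?thesis using assms that by auto
qed

lemma partition_bounds:
  fixes a :: "nat \<Rightarrow> real"
  assumes "a 0 = 0" "a n = 1" "\<And>i. i < n \<Longrightarrow> a i < a (Suc i)" "i < n"
  shows "0 \<le> a i" "a (Suc i) \<le> 1"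
proof -
  have "k \<le> n \<Longrightarrow> 0 \<le> a k" for k
    proof (induction k)
    case (Suc k)
    then show ?case using assms(3)[of k] by simp
  qed (simp add: assms(1))
  then show "0 \<le> a i" using assms by simp
  have "a (n - k) \<le> 1" for k
  proof (induction k)
    case (Suc k)
    show ?case
    proof (cases "n - k = 0")
      case False
      then have "a (n - Suc k) < a (Suc (n - Suc k))" using assms(3)[of "n - Suc k"] by linarith
      with Suc False show ?thesis by (simp add: Suc_diff_Suc)
    qed (use Suc in auto)
  qed (use assms in auto)
  from this[of "n - Suc i"] assms show "a (Suc i) \<le> 1" by simp
qed

lemma HM_setI:
  assumes f: "f \<in> {0..<1} \<rightarrow>\<^sub>E topspace T"
    and F: "finite F" "{0, 1} \<subseteq> F" "F \<subseteq> {0..1}"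
    and const: "\<And>x y. 0 \<le> x \<Longrightarrow> x \<le> y \<Longrightarrow> y < 1 \<Longrightarrow> {x<..y} \<inter> F = {} \<Longrightarrow> f x = f y"
  shows "f \<in> HM_set T"
proof -
  define l where "l = sorted_list_of_set F"
  have l: "set l = F" "sorted_wrt (<) l" "length l = card F"
    using F(1) by (auto simp: l_def)
  have mono: "i < j \<Longrightarrow> j < length l \<Longrightarrow> l ! i < l ! j" for i j
    using l(2) by (simp add: sorted_wrt_iff_nth_less)
  have in01: "i < length l \<Longrightarrow> l ! i \<in> {0..1}" for i
    using l(1) F(3) nth_mem by blast
  obtain i0 where i0: "i0 < length l" "l ! i0 = 0"
    using F(2) l(1) by (metis in_set_conv_nth insertI1 subsetD)
  obtain i1 where i1: "i1 < length l" "l ! i1 = 1"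
    using F(2) l(1) by (metis in_set_conv_nth insertI1 insert_commute subsetD)
  define n where "n = length l - 1"
  have len: "length l = Suc n" using i0 by (simp add: n_def)
  have "i0 = 0"
  proof (rule ccontr)
    assume "i0 \<noteq> 0"
    then have "l ! 0 < l ! i0" using mono[of 0 i0] i0 by simp
    then show False using in01[of 0] i0 len by simp
  qed
  then have l0: "l ! 0 = 0" using i0 by simp
  have "i1 = n"
  proof (rule ccontr)
    assume "i1 \<noteq> n"
    then have "l ! i1 < l ! n" using mono[of i1 n] i1 len by simp
    then show False using in01[of n] i1 len by simp
  qed
  then have ln: "l ! n = 1" using i1 by simp
  have "\<exists>c. \<forall>t\<in>{l ! i..<l ! Suc i}. f t = c" if i: "i < n" for i
  proof (intro exI ballI)
    fix t assume t: "t \<in> {l ! i..<l ! Suc i}"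
    have "{l ! i<..t} \<inter> F = {}"
    proof (rule ccontr)
      assume "{l ! i<..t} \<inter> F \<noteq> {}"
      then obtain j where j: "j < length l" "l ! i < l ! j" "l ! j < l ! Suc i"
        using t l(1) by (fastforce simp: in_set_conv_nth)
      have "i < j" using mono[of j i] i len j by (cases i j rule: linorder_cases) auto
      moreover have "j < Suc i" using mono[of "Suc i" j] j by (cases j "Suc i" rule: linorder_cases) auto
      ultimately show False by simp
    qed
    then show "f t = f (l ! i)"
      using const[of "l ! i" t] t in01[of i] in01[of "Suc i"] i len by auto
  qed
  then show ?thesis
    unfolding HM_set_def using f l0 ln mono len
    by (auto intro!: exI[of _ n] exI[of _ "\<lambda>i. l ! i"])
qed

lemma HM_setE:
  assumes "f \<in> HM_set T"
  obtains F where "finite F" "{0, 1} \<subseteq> F" "F \<subseteq> {0..1}"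
    "\<And>x y. 0 \<le> x \<Longrightarrow> x \<le> y \<Longrightarrow> y < 1 \<Longrightarrow> {x<..y} \<inter> F = {} \<Longrightarrow> f x = f y"
proof -
  obtain n p where p: "p 0 = 0" "p n = 1" "\<forall>i<n. p i < p (Suc i)"
    "\<forall>i<n. \<exists>c. \<forall>t\<in>{p i..<p (Suc i)}. f t = c"
    using assms unfolding HM_set_def by blast
  have bd: "0 \<le> p i" "p (Suc i) \<le> 1" if "i < n" for i
    using partition_bounds[OF p(1,2)] p(3) that by blast+
  have p01: "p i \<in> {0..1}" if "i \<le> n" for i
  proof (cases "i = n")
    case False
    then have "i < n" using that by simp
    then have "0 \<le> p i" "p i < p (Suc i)" "p (Suc i) \<le> 1" using bd p(3) by auto
    then show ?thesis by simp
  qed (simp add: p(2))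
  show ?thesis
  proof (rule that[of "p ` {..n}"])
    show "{0, 1} \<subseteq> p ` {..n}" using p(1,2) by force
    show "p ` {..n} \<subseteq> {0..1}" using p01 by blast
    fix x y :: real assume xy: "0 \<le> x" "x \<le> y" "y < 1" "{x<..y} \<inter> p ` {..n} = {}"
    obtain i where i: "i < n" "x \<in> {p i..<p (Suc i)}"
      using partition_cell[OF p(1,2), of x] xy by auto
    have "p (Suc i) \<notin> {x<..y}" using xy(4) i(1) by (auto simp: Suc_le_eq disjoint_iff)
    then have "y \<in> {p i..<p (Suc i)}" using i xy by auto
    then show "f x = f y" using p(4) i by metis
  qed simp
qed

lemma HM_set_pointwise:
  assumes f: "f \<in> HM_set T" and g: "g \<in> HM_set T"
    and h: "\<And>x y. x \<in> topspace T \<Longrightarrow> y \<in> topspace T \<Longrightarrow> h x y \<in> topspace T"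
  shows "(\<lambda>t\<in>{0..<1}. h (f t) (g t)) \<in> HM_set T"
proof -
  obtain F where F: "finite F" "{0, 1} \<subseteq> F" "F \<subseteq> {0..1}"
    "\<And>x y. 0 \<le> x \<Longrightarrow> x \<le> y \<Longrightarrow> y < 1 \<Longrightarrow> {x<..y} \<inter> F = {} \<Longrightarrow> f x = f y"
    using HM_setE[OF f] by metis
  obtain G where G: "finite G" "{0, 1} \<subseteq> G" "G \<subseteq> {0..1}"
    "\<And>x y. 0 \<le> x \<Longrightarrow> x \<le> y \<Longrightarrow> y < 1 \<Longrightarrow> {x<..y} \<inter> G = {} \<Longrightarrow> g x = g y"
    using HM_setE[OF g] by metis
  show ?thesis
  proof (rule HM_setI[of _ _ "F \<union> G"])
    show "(\<lambda>t\<in>{0..<1}. h (f t) (g t)) \<in> {0..<1} \<rightarrow>\<^sub>E topspace T"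
      using f g h by (auto simp: HM_set_def PiE_iff)
    fix x y :: real assume xy: "0 \<le> x" "x \<le> y" "y < 1" "{x<..y} \<inter> (F \<union> G) = {}"
    then have "f x = f y" "g x = g y" using F(4) G(4) by (auto simp: Int_Un_distrib)
    then show "(\<lambda>t\<in>{0..<1}. h (f t) (g t)) x = (\<lambda>t\<in>{0..<1}. h (f t) (g t)) y"
      using xy by simp
  qed (use F G in auto)
qed

lemma HM_set_vimage_borel:
  assumes "f \<in> HM_set T" "0 \<le> a" "b \<le> 1"
  shows "{a..<b} - f -` U \<in> sets borel"
proof -
  obtain n p where p: "p 0 = 0" "p n = 1" "\<forall>i<n. p i < p (Suc i)"
    "\<forall>i<n. \<exists>c. \<forall>t\<in>{p i..<p (Suc i)}. f t = c"
    using assms(1) unfolding HM_set_def by blast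
  have "{a..<b} - f -` U =
      (\<Union>i\<in>{i. i < n \<and> f (p i) \<notin> U}. {a..<b} \<inter> {p i..<p (Suc i)})" (is "_ = ?R")
  proof (intro set_eqI iffI)
    fix t assume t: "t \<in> {a..<b} - f -` U"
    then obtain i where i: "i < n" "t \<in> {p i..<p (Suc i)}"
      using partition_cell[OF p(1,2), of t] assms by auto
    then have "f t = f (p i)" using p(3,4) by (metis atLeastLessThan_iff order_refl)
    then show "t \<in> ?R" using t i by auto
  next
    fix t assume "t \<in> ?R"
    then obtain i where i: "i < n" "f (p i) \<notin> U" "t \<in> {a..<b}" "t \<in> {p i..<p (Suc i)}" by auto
    then have "f t = f (p i)" using p(3,4) by (metis atLeastLessThan_iff order_refl)
    then show "t \<in> {a..<b} - f -` U" using i by auto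
  qed
  then show ?thesis by simp
qed

text \<open>Squaring changes the measure of subsets of \<open>[0,1)\<close> in a uniformly controlled way.\<close>

lemma square_measure_bounds:
  assumes A [measurable]: "A \<in> sets borel" and "A \<subseteq> {0..<1::real}"
  shows "measure lebesgue ((\<lambda>t. t\<^sup>2) ` A) \<le> 2 * measure lebesgue A"
    and "(measure lebesgue A)\<^sup>2 \<le> 2 * measure lebesgue ((\<lambda>t. t\<^sup>2) ` A)"
    and "(\<lambda>t. t\<^sup>2) ` A \<in> sets borel"
proof -
  define B where "B = {u \<in> {0..<1}. sqrt u \<in> A}"
  have B_eq: "(\<lambda>t. t\<^sup>2) ` A = B"
  proof (intro set_eqI iffI)
    fix u assume "u \<in> (\<lambda>t. t\<^sup>2) ` A"
    then show "u \<in> B" using assms(2) by (fastforce simp: B_def power_less_one_iff)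
  next
    fix u assume "u \<in> B"
    then show "u \<in> (\<lambda>t. t\<^sup>2) ` A"
      by (auto simp: B_def intro!: image_eqI[of _ _ "sqrt u"])
  qed
  have [measurable]: "B \<in> sets borel"
  proof -
    have "B = {0..<1} \<inter> (sqrt -` A \<inter> space borel)" by (auto simp: B_def)
    moreover have "sqrt -` A \<inter> space borel \<in> sets borel"
      by (rule measurable_sets[OF _ A]) simp
    ultimately show ?thesis by auto
  qed
  then show "(\<lambda>t. t\<^sup>2) ` A \<in> sets borel" using B_eq by simp
  have fin: "emeasure lborel C < \<infinity>" if "C \<subseteq> {0..<1}" for C :: "real set"
    using emeasure_mono[OF that, of lborel] by (simp add: order_le_less_trans)
  have B01: "B \<subseteq> {0..<1}" by (auto simp: B_def)
  have key: "emeasure lborel B = (\<integral>\<^sup>+x. ennreal (2 * x) * indicator A x \<partial>lborel)"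
  proof -
    have "emeasure lborel B = (\<integral>\<^sup>+x. indicator B x * indicator {0\<^sup>2..1\<^sup>2} x \<partial>lborel)"
    proof -
      have "(indicator B x :: ennreal) * indicator {0\<^sup>2..1\<^sup>2} x = indicator B x" for x
        by (auto simp: B_def indicator_def)
      then show ?thesis by simp
    qed
    also have "\<dots> = (\<integral>\<^sup>+x. indicator B (x\<^sup>2) * ennreal (2 * x) * indicator {0..1} x \<partial>lborel)"
      by (rule nn_integral_substitution_aux[where g = "\<lambda>x. x\<^sup>2"])
        (auto intro!: derivative_eq_intros continuous_intros)
    also have "\<dots> = (\<integral>\<^sup>+x. ennreal (2 * x) * indicator A x \<partial>lborel)"
    proof (rule nn_integral_cong)
      fix x :: real
      have "x\<^sup>2 \<in> B \<longleftrightarrow> x \<in> A" if "0 \<le> x" "x \<le> 1"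
        using that assms(2) by (auto simp: B_def power_less_one_iff real_sqrt_unique)
      then show "indicator B (x\<^sup>2) * ennreal (2 * x) * indicator {0..1} x
          = ennreal (2 * x) * indicator A x"
        using assms(2) by (auto simp: indicator_def)
    qed
    finally show ?thesis .
  qed
  have mB: "emeasure lborel B = ennreal (measure lborel B)"
    using fin[OF B01] by (intro emeasure_eq_ennreal_measure) auto
  have mC: "emeasure lborel C = ennreal (measure lborel C)" if "C \<subseteq> {0..<1}" for C :: "real set"
    using fin[OF that] by (intro emeasure_eq_ennreal_measure) auto
  have up: "measure lborel B \<le> 2 * measure lborel A"
  proof -
    have "emeasure lborel B \<le> (\<integral>\<^sup>+x. 2 * indicator A x \<partial>lborel)"
      unfolding key using assms(2)
      by (intro nn_integral_mono)
        (auto simp: indicator_def ennreal_numeral[symmetric] simp del: ennreal_numeral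
          intro!: ennreal_leI)
    also have "\<dots> = 2 * emeasure lborel A" by (simp add: nn_integral_cmult)
    also have "\<dots> = ennreal (2 * measure lborel A)"
      using mC[OF assms(2)] by (simp add: ennreal_mult)
    finally show ?thesis using mB by (simp add: ennreal_le_iff)
  qed
  then show "measure lebesgue ((\<lambda>t. t\<^sup>2) ` A) \<le> 2 * measure lebesgue A"
    by (simp add: B_eq)
  define m where "m = measure lborel A"
  have m0: "0 \<le> m" by (simp add: m_def)
  define A' where "A' = A - {0..<m/2}"
  have [measurable]: "A' \<in> sets borel" by (simp add: A'_def)
  have A'01: "A' \<subseteq> {0..<1}" using assms(2) by (auto simp: A'_def)
  have half: "m \<le> m / 2 + measure lborel A'"
  proof -
    have "emeasure lborel A \<le> emeasure lborel ({0..<m/2} \<union> A')"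
      by (intro emeasure_mono) (auto simp: A'_def)
    also have "\<dots> \<le> emeasure lborel {0..<m/2} + emeasure lborel A'"
      by (intro emeasure_subadditive) auto
    also have "\<dots> = ennreal (m / 2 + measure lborel A')"
      using m0 mC[OF A'01] by (simp add: ennreal_plus)
    finally have "ennreal m \<le> ennreal (m / 2 + measure lborel A')"
      using mC[OF assms(2)] by (simp only: m_def)
    then show ?thesis using m0 by (subst (asm) ennreal_le_iff) auto
  qed
  have "ennreal (m * measure lborel A') = (\<integral>\<^sup>+x. ennreal m * indicator A' x \<partial>lborel)"
    using m0 mC[OF A'01] by (simp add: nn_integral_cmult ennreal_mult)
  also have "\<dots> \<le> emeasure lborel B"
    unfolding key using assms(2)
    by (intro nn_integral_mono) (auto simp: indicator_def A'_def intro!: ennreal_leI)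
  finally have "m * measure lborel A' \<le> measure lborel B"
    using mB by (simp add: ennreal_le_iff)
  moreover have "m * (m / 2) \<le> m * measure lborel A'"
    using half m0 by (intro mult_left_mono) auto
  ultimately show "(measure lebesgue A)\<^sup>2 \<le> 2 * measure lebesgue ((\<lambda>t. t\<^sup>2) ` A)"
    unfolding B_eq using m0 by (simp add: m_def power2_eq_square)
qed

lemma HM_reparametrize_closed:
  assumes r: "strict_mono_on {0..1} r" "r ` {0..1} = {0..1::real}" "f \<in> HM_set T"
  shows "(\<lambda>t\<in>{0..<1}. f (r t)) \<in> HM_set T"
proof -
  obtain n p where p: "p 0 = 0" "p n = 1" "\<forall>i<n. p i < p (Suc i)"
    "\<forall>i<n. \<exists>c. \<forall>t\<in>{p i..<p (Suc i)}. f t = c" and f: "f \<in> {0..<1} \<rightarrow>\<^sub>E topspace T"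
    using assms(3) unfolding HM_set_def by blast
  have bd: "0 \<le> p i" "p (Suc i) \<le> 1" if "i < n" for i
    using partition_bounds[OF p(1,2)] p(3) that by blast+
  have p01: "p i \<in> {0..1}" if "i \<le> n" for i
  proof (cases "i = n")
    case False
    then have "i < n" using that by simp
    then have "0 \<le> p i" "p i < p (Suc i)" "p (Suc i) \<le> 1" using bd p(3) by auto
    then show ?thesis by simp
  qed (simp add: p(2))
  define q where "q i = the_inv_into {0..1} r (p i)" for i
  have inj: "inj_on r {0..1}" using r(1) by (rule strict_mono_on_imp_inj_on)
  have q01: "q i \<in> {0..1}" and rq: "r (q i) = p i" if "i \<le> n" for i
    using p01[OF that] inj r(2) unfolding q_def
    by (auto intro!: the_inv_into_into[OF inj] f_the_inv_into_f simp del: atLeastAtMost_iff)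
  have less: "r x < r y \<longleftrightarrow> x < y" if "x \<in> {0..1}" "y \<in> {0..1}" for x y
    using strict_mono_on_less[OF r(1) that] .
  have r01: "r x \<in> {0..1}" if "x \<in> {0..1}" for x using r(2) that by blast
  have r0: "r 0 = 0"
  proof -
    obtain x where "x \<in> {0..1}" "r x = 0" using r(2) by (metis atLeastAtMost_iff imageE order_refl zero_le_one)
    then show ?thesis using less[of 0 x] r01[of 0] by (cases "x = 0") auto
  qed
  have r1: "r 1 = 1"
  proof -
    obtain x where "x \<in> {0..1}" "r x = 1" using r(2) by (metis atLeastAtMost_iff imageE order_refl zero_le_one)
    then show ?thesis using less[of x 1] r01[of 1] by (cases "x = 1") auto
  qed
  have q: "q 0 = 0" "q n = 1"
    using rq[of 0] rq[of n] r0 r1 p(1,2) q01[of 0] q01[of n] inj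
    by (auto simp: inj_on_def)
  have qlt: "\<forall>i<n. q i < q (Suc i)"
    using p(3) rq less q01 by (metis Suc_leI less_imp_le)
  have rt: "r t \<in> {0..<1}" if "t \<in> {0..<1}" for t
    using less[of t 1] r01[of t] r1 that by auto
  have "\<exists>c. \<forall>t\<in>{q i..<q (Suc i)}. (\<lambda>t\<in>{0..<1}. f (r t)) t = c" if i: "i < n" for i
  proof -
    obtain c where c: "\<forall>t\<in>{p i..<p (Suc i)}. f t = c" using p(4) i by blast
    have "(\<lambda>t\<in>{0..<1}. f (r t)) t = c" if t: "t \<in> {q i..<q (Suc i)}" for t
    proof -
      have qq: "q i \<in> {0..1}" "q (Suc i) \<in> {0..1}" using q01 i by auto
      then have t01: "t \<in> {0..1}" "t \<in> {0..<1}" using t by auto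
      have "p i \<le> r t" "r t < p (Suc i)"
        using less[OF t01(1) qq(1)] less[OF t01(1) qq(2)] t rq[of i] rq[of "Suc i"] i by auto
      then show ?thesis using c t01 by auto
    qed
    then show ?thesis by blast
  qed
  moreover have "(\<lambda>t\<in>{0..<1}. f (r t)) \<in> {0..<1} \<rightarrow>\<^sub>E topspace T"
    using f rt by (auto simp: PiE_iff)
  ultimately show ?thesis
    using q qlt unfolding HM_set_def by blast
qed

lemma HM_reparametrize_continuous:
  assumes r: "strict_mono_on {0..1} r" "r ` {0..1} = {0..1::real}"
    and meas: "\<And>B. B \<in> sets borel \<Longrightarrow> B \<subseteq> {0..<1} \<Longrightarrow> {t\<in>{0..<1}. r t \<in> B} \<in> sets borel"
    and ac: "\<And>\<epsilon>. 0 < \<epsilon> \<Longrightarrow> \<exists>\<delta>>0. \<forall>B. B \<in> sets borel \<longrightarrow> B \<subseteq> {0..<1} \<longrightarrow>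
               measure lebesgue B < \<delta> \<longrightarrow> measure lebesgue {t\<in>{0..<1}. r t \<in> B} < \<epsilon>"
  shows "continuous_map (HM_topology T) (HM_topology T) (\<lambda>f. \<lambda>t\<in>{0..<1}. f (r t))"
    (is "continuous_map _ _ ?R")
proof -
  have sub: "openin (HM_topology T) {f \<in> HM_set T. ?R f \<in> HM_nbh T U a b \<epsilon>}"
    if U: "openin T U" and ab: "0 \<le> a" "a < b" "b \<le> 1" and \<epsilon>: "0 < \<epsilon>" for U a b \<epsilon>
  proof (subst openin_subopen, intro ballI)
    fix f assume "f \<in> {f \<in> HM_set T. ?R f \<in> HM_nbh T U a b \<epsilon>}"
    then have f: "f \<in> HM_set T" and Rf: "measure lebesgue ({a..<b} - ?R f -` U) < \<epsilon>"
      by (auto simp: HM_nbh_def)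
    define \<epsilon>' where "\<epsilon>' = \<epsilon> - measure lebesgue ({a..<b} - ?R f -` U)"
    have "0 < \<epsilon>'" using Rf by (simp add: \<epsilon>'_def)
    then obtain \<delta> where \<delta>: "\<delta> > 0" "\<And>B. B \<in> sets borel \<Longrightarrow> B \<subseteq> {0..<1} \<Longrightarrow>
               measure lebesgue B < \<delta> \<Longrightarrow> measure lebesgue {t\<in>{0..<1}. r t \<in> B} < \<epsilon>'"
      using ac[of \<epsilon>'] by blast
    obtain n p where p: "p 0 = 0" "p n = 1" "\<forall>i<n. p i < p (Suc i)"
      "\<forall>i<n. \<exists>c. \<forall>t\<in>{p i..<p (Suc i)}. f t = c"
      using f unfolding HM_set_def by blast
    have n: "n > 0" using p(1,2) by (cases n) auto
    have bd: "0 \<le> p i" "p (Suc i) \<le> 1" if "i < n" for i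
      using partition_bounds[OF p(1,2)] p(3) that by blast+
    define I where "I = {i. i < n \<and> f (p i) \<in> U}"
    have fI: "finite I" and cI: "card I \<le> n"
      using card_mono[of "{..<n}" I] by (auto simp: I_def)
    define V where "V = HM_set T \<inter> (\<Inter>i\<in>I. HM_nbh T U (p i) (p (Suc i)) (\<delta> / n))"
    have fconst: "f t = f (p i)" if "i < n" "t \<in> {p i..<p (Suc i)}" for i t
      using p(3,4) that by (metis atLeastLessThan_iff order_refl)
    have "openin (HM_topology T) V"
    proof -
      have "openin (HM_topology T) (HM_nbh T U (p i) (p (Suc i)) (\<delta> / n))" if "i \<in> I" for i
        unfolding HM_topology_def
        by (rule topology_generated_by_Basis)
          (use that U bd p(3) \<delta>(1) n in \<open>auto simp: I_def intro!: exI\<close>)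
      moreover have "openin (HM_topology T) (HM_set T)"
        using openin_topspace[of "HM_topology T"] by simp
      ultimately show ?thesis
        unfolding V_def using fI
        by (cases "I = {}") (auto simp: INF_eq_const intro!: openin_Int openin_INT2)
    qed
    moreover have "f \<in> V"
    proof -
      have "f \<in> HM_nbh T U (p i) (p (Suc i)) (\<delta> / n)" if "i \<in> I" for i
      proof -
        have "{p i..<p (Suc i)} - f -` U = {}"
        proof -
          have "f t \<in> U" if "t \<in> {p i..<p (Suc i)}" for t
            using fconst[OF _ that] \<open>i \<in> I\<close> by (simp only: I_def mem_Collect_eq)
          then show ?thesis by blast
        qed
        then have "measure lebesgue ({p i..<p (Suc i)} - f -` U) = 0"
          by (simp only: measure_empty)
        moreover have "0 < \<delta> / n" using \<delta>(1) n by simp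
        ultimately show ?thesis using f by (simp only: HM_nbh_def mem_Collect_eq simp_thms)
      qed
      then show ?thesis using f unfolding V_def by blast
    qed
    moreover have "V \<subseteq> {f \<in> HM_set T. ?R f \<in> HM_nbh T U a b \<epsilon>}"
    proof
      fix g assume "g \<in> V"
      then have g: "g \<in> HM_set T" and gI: "\<And>i. i \<in> I \<Longrightarrow>
          measure lebesgue ({p i..<p (Suc i)} - g -` U) < \<delta> / n"
        by (auto simp: V_def HM_nbh_def)
      define B where "B = (\<Union>i\<in>I. {p i..<p (Suc i)} - g -` U)"
      have Bi: "{p i..<p (Suc i)} - g -` U \<in> sets borel" if "i \<in> I" for i
        using HM_set_vimage_borel[OF g] bd that by (auto simp: I_def)
      have "B \<in> sets borel"
        unfolding B_def using fI Bi by (intro sets.finite_UN) auto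
      moreover have "B \<subseteq> {0..<1}"
      proof
        fix t assume "t \<in> B"
        then obtain i where "i < n" "p i \<le> t" "t < p (Suc i)" by (auto simp: B_def I_def)
        then show "t \<in> {0..<1}" using bd[of i] by auto
      qed
      ultimately have B: "B \<in> sets borel" "B \<subseteq> {0..<1}" by auto
      have lm: "{p i..<p (Suc i)} - g -` U \<in> lmeasurable" if "i \<in> I" for i
        using Bi[OF that] by (intro bounded_set_imp_lmeasurable) (auto intro: bounded_subset[of "{p i..<p (Suc i)}"])
      have "measure lebesgue B < \<delta>"
      proof (cases "I = {}")
        case False
        have "measure lebesgue B \<le> (\<Sum>i\<in>I. measure lebesgue ({p i..<p (Suc i)} - g -` U))"
          unfolding B_def using fI lm by (intro measure_UNION_le) auto
        also have "\<dots> < (\<Sum>i\<in>I. \<delta> / n)"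
          using fI False gI by (intro sum_strict_mono) auto
        also have "\<dots> \<le> n * (\<delta> / n)"
          using cI \<delta>(1) n by (simp add: field_simps)
        finally show ?thesis using n by simp
      qed (use \<delta>(1) in \<open>simp add: B_def\<close>)
      then have rB: "measure lebesgue {t\<in>{0..<1}. r t \<in> B} < \<epsilon>'"
        using \<delta>(2) B by blast
      have Rc: "?R h \<in> HM_set T" if "h \<in> HM_set T" for h
        using HM_reparametrize_closed[OF r that] .
      have incl: "{a..<b} - ?R g -` U \<subseteq> ({a..<b} - ?R f -` U) \<union> {t\<in>{0..<1}. r t \<in> B}"
      proof
        fix t assume t: "t \<in> {a..<b} - ?R g -` U"
        then have t01: "t \<in> {0..<1}" using ab by auto
        have "r t < r 1" using t01 by (intro strict_mono_onD[OF r(1)]) auto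
        moreover have "r 1 \<in> {0..1}" "r t \<in> {0..1}"
          using imageI[of 1 "{0..1}" r] imageI[of t "{0..1}" r] t01 unfolding r(2) by auto
        ultimately have rt: "r t \<in> {0..<1}" by simp
        show "t \<in> ({a..<b} - ?R f -` U) \<union> {t\<in>{0..<1}. r t \<in> B}"
        proof (cases "f (r t) \<in> U")
          case True
          obtain i where i: "i < n" "r t \<in> {p i..<p (Suc i)}"
            using partition_cell[OF p(1,2) rt] by blast
          have "i \<in> I"
            using True i(1) unfolding fconst[OF i] by (simp only: I_def mem_Collect_eq simp_thms)
          then have "r t \<in> B" using i t t01 unfolding B_def by auto
          then show ?thesis using t01 by blast
        qed (use t t01 in auto)
      qed
      have bnd: "C \<in> lmeasurable" if "C \<in> sets borel" "C \<subseteq> {0..<1}" for C :: "real set"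
        using that by (intro bounded_set_imp_lmeasurable) (auto intro: bounded_subset[of "{0..<1}"])
      have m1: "{a..<b} - ?R f -` U \<in> lmeasurable" "{a..<b} - ?R g -` U \<in> lmeasurable"
        using HM_set_vimage_borel[OF Rc[OF f] ab(1,3)] HM_set_vimage_borel[OF Rc[OF g] ab(1,3)] ab
        by (auto intro!: bnd)
      have m2: "{t\<in>{0..<1}. r t \<in> B} \<in> lmeasurable"
        using meas[OF B] by (intro bnd) auto
      have "measure lebesgue ({a..<b} - ?R g -` U)
          \<le> measure lebesgue (({a..<b} - ?R f -` U) \<union> {t\<in>{0..<1}. r t \<in> B})"
        using incl m1 m2 by (intro measure_mono_fmeasurable) auto
      also have "\<dots> \<le> measure lebesgue ({a..<b} - ?R f -` U)
          + measure lebesgue {t\<in>{0..<1}. r t \<in> B}"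
        using m1 m2 by (intro measure_Un_le) auto
      also have "\<dots> < \<epsilon>" using rB by (simp add: \<epsilon>'_def)
      finally show "g \<in> {f \<in> HM_set T. ?R f \<in> HM_nbh T U a b \<epsilon>}"
        using g Rc[OF g] by (simp add: HM_nbh_def)
    qed
    ultimately show "\<exists>V. openin (HM_topology T) V \<and> f \<in> V \<and>
        V \<subseteq> {f \<in> HM_set T. ?R f \<in> HM_nbh T U a b \<epsilon>}" by blast
  qed
  have "continuous_map (HM_topology T) (topology_generated_by
     {HM_nbh T U a b \<epsilon> | U a b \<epsilon>. openin T U \<and> 0 \<le> a \<and> a < b \<and> b \<le> 1 \<and> 0 < \<epsilon>}) ?R"
  proof (rule continuous_on_generated_topo)
    fix N assume "N \<in> {HM_nbh T U a b \<epsilon> | U a b \<epsilon>.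
        openin T U \<and> 0 \<le> a \<and> a < b \<and> b \<le> 1 \<and> 0 < \<epsilon>}"
    then obtain U a b \<epsilon> where N: "N = HM_nbh T U a b \<epsilon>"
      and c: "openin T U" "0 \<le> a" "a < b" "b \<le> 1" "0 < \<epsilon>" by blast
    have "?R -` N \<inter> topspace (HM_topology T) = {f \<in> HM_set T. ?R f \<in> HM_nbh T U a b \<epsilon>}"
      unfolding N by auto
    then show "openin (HM_topology T) (?R -` N \<inter> topspace (HM_topology T))"
      using sub[OF c] by simp
  next
    show "?R ` topspace (HM_topology T) \<subseteq> \<Union> {HM_nbh T U a b \<epsilon> | U a b \<epsilon>.
        openin T U \<and> 0 \<le> a \<and> a < b \<and> b \<le> 1 \<and> 0 < \<epsilon>}"
      unfolding topology_generated_by_topspace[symmetric] HM_topology_def[symmetric]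
      using HM_reparametrize_closed[OF r] by auto
  qed
  then show ?thesis by (simp only: HM_topology_def)
qed

lemma square_reparam:
  "strict_mono_on {0..1} (\<lambda>t::real. t\<^sup>2)" "(\<lambda>t::real. t\<^sup>2) ` {0..1} = {0..1}"
proof -
  show "strict_mono_on {0..1} (\<lambda>t::real. t\<^sup>2)"
    by (intro strict_mono_onI) (auto intro: power_strict_mono)
  show "(\<lambda>t::real. t\<^sup>2) ` {0..1} = {0..1}"
    by (auto simp: power_le_one intro!: image_eqI[of _ _ "sqrt _"])
qed

lemma sqrt_reparam:
  "strict_mono_on {0..1} sqrt" "sqrt ` {0..1} = {0..1}"
proof -
  show "strict_mono_on {0..1} sqrt" by (intro strict_mono_onI) auto
  show "sqrt ` {0..1} = {0..1}"
  proof (intro subset_antisym subsetI)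
    fix x :: real assume "x \<in> {0..1}"
    then show "x \<in> sqrt ` {0..1}" by (intro image_eqI[of _ _ "x\<^sup>2"]) (auto simp: power_le_one)
  qed auto
qed

lemma continuous_map_HM_shift:
  "continuous_map (HM_topology T) (HM_topology T) HM_shift"
  unfolding HM_shift_def
proof (rule HM_reparametrize_continuous[OF square_reparam])
  fix B :: "real set" assume B [measurable]: "B \<in> sets borel" and "B \<subseteq> {0..<1}"
  show "{t\<in>{0..<1}. t\<^sup>2 \<in> B} \<in> sets borel"
  proof -
    have "{t\<in>{0..<1}. t\<^sup>2 \<in> B} = {0..<1} \<inter> ((\<lambda>t. t\<^sup>2) -` B \<inter> space borel)" by auto
    moreover have "(\<lambda>t::real. t\<^sup>2) -` B \<inter> space borel \<in> sets borel"
      by (rule measurable_sets[OF _ B]) simp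
    ultimately show ?thesis by auto
  qed
next
  fix \<epsilon> :: real assume \<epsilon>: "0 < \<epsilon>"
  have "measure lebesgue {t\<in>{0..<1}. t\<^sup>2 \<in> B} < \<epsilon>"
    if B: "B \<in> sets borel" "B \<subseteq> {0..<1}" and mB: "measure lebesgue B < \<epsilon>\<^sup>2 / 2" for B :: "real set"
  proof -
    define A where "A = {t\<in>{0..<1}. t\<^sup>2 \<in> B}"
    have "A = {0..<1} \<inter> ((\<lambda>t. t\<^sup>2) -` B \<inter> space borel)" by (auto simp: A_def)
    moreover have "(\<lambda>t::real. t\<^sup>2) -` B \<inter> space borel \<in> sets borel"
      by (rule measurable_sets[OF _ B(1)]) simp
    ultimately have A: "A \<in> sets borel" "A \<subseteq> {0..<1}" by auto
    have "(\<lambda>t. t\<^sup>2) ` A = B"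
    proof (intro subset_antisym subsetI)
      fix u assume "u \<in> B"
      then show "u \<in> (\<lambda>t. t\<^sup>2) ` A"
        using B(2) by (intro image_eqI[of _ _ "sqrt u"]) (auto simp: A_def)
    qed (auto simp: A_def)
    with square_measure_bounds(2)[OF A] mB have "(measure lebesgue A)\<^sup>2 < \<epsilon>\<^sup>2" by simp
    then have "measure lebesgue A < \<epsilon>"
      by (rule power2_less_imp_less) (use \<epsilon> in simp)
    then show ?thesis by (simp only: A_def)
  qed
  then show "\<exists>\<delta>>0. \<forall>B::real set. B \<in> sets borel \<longrightarrow> B \<subseteq> {0..<1} \<longrightarrow>
      measure lebesgue B < \<delta> \<longrightarrow> measure lebesgue {t\<in>{0..<1}. t\<^sup>2 \<in> B} < \<epsilon>"
    using \<epsilon> by (intro exI[of _ "\<epsilon>\<^sup>2 / 2"]) simp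
qed

lemma continuous_map_HM_unshift:
  "continuous_map (HM_topology T) (HM_topology T) (\<lambda>\<gamma>. \<lambda>t\<in>{0..<1}. \<gamma> (sqrt t))"
proof (rule HM_reparametrize_continuous[OF sqrt_reparam])
  have eq: "{t\<in>{0..<1}. sqrt t \<in> B} = (\<lambda>t. t\<^sup>2) ` B" if "B \<subseteq> {0..<1}" for B
  proof (intro subset_antisym subsetI)
    fix u assume "u \<in> {t\<in>{0..<1}. sqrt t \<in> B}"
    then show "u \<in> (\<lambda>t. t\<^sup>2) ` B" by (intro image_eqI[of _ _ "sqrt u"]) auto
  qed (use that in \<open>fastforce simp: power_less_one_iff\<close>)
  show "{t\<in>{0..<1}. sqrt t \<in> B} \<in> sets borel" if "B \<in> sets borel" "B \<subseteq> {0..<1}" for B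
    using square_measure_bounds(3)[OF that] eq[OF that(2)] by simp
  show "\<exists>\<delta>>0. \<forall>B. B \<in> sets borel \<longrightarrow> B \<subseteq> {0..<1} \<longrightarrow>
      measure lebesgue B < \<delta> \<longrightarrow> measure lebesgue {t\<in>{0..<1}. sqrt t \<in> B} < \<epsilon>"
    if \<epsilon>: "0 < \<epsilon>" for \<epsilon>
  proof -
    have "measure lebesgue {t\<in>{0..<1}. sqrt t \<in> B} < \<epsilon>"
      if "B \<in> sets borel" "B \<subseteq> {0..<1}" "measure lebesgue B < \<epsilon> / 2" for B
      using square_measure_bounds(1)[OF that(1,2)] that(3) unfolding eq[OF that(2)] by linarith
    then show ?thesis using \<epsilon> by (intro exI[of _ "\<epsilon> / 2"]) simp
  qed
qed

lemma carr_HM0: "carr (HM0 X) = {f \<in> HM_set (topo X). f 0 = magma_unit X}"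
  by (auto simp: HM0_def HM_def restrict_magma_def)

lemma is_unit_of_HM0:
  assumes "unital_topologized_magma X"
  shows "is_unit_of (HM0 X) (\<lambda>t\<in>{0..<1}. magma_unit X)"
proof -
  have e: "is_unit_of X (magma_unit X)" using assms by (rule is_unit_of_magma_unit)
  have "(\<lambda>t\<in>{0..<1}. magma_unit X) \<in> HM_set (topo X)"
    using e unfolding HM_set_def is_unit_of_def
    by (auto intro!: exI[of _ 1] exI[of _ "\<lambda>i. real i"])
  moreover have "(\<lambda>t\<in>{0..<1}. mul X (magma_unit X) (f t)) = f"
    "(\<lambda>t\<in>{0..<1}. mul X (f t) (magma_unit X)) = f" if "f \<in> HM_set (topo X)" for f
  proof -
    have "f \<in> {0..<1} \<rightarrow>\<^sub>E carr X" using that by (simp add: HM_set_def)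
    then show "(\<lambda>t\<in>{0..<1}. mul X (magma_unit X) (f t)) = f"
      "(\<lambda>t\<in>{0..<1}. mul X (f t) (magma_unit X)) = f"
      using e by (auto simp: is_unit_of_def PiE_iff fun_eq_iff extensional_def)
  qed
  ultimately show ?thesis
    unfolding is_unit_of_def carr_HM0
    by (auto simp: HM0_def HM_def restrict_magma_def cong: restrict_cong)
qed

lemma automorphism_HM_shift:
  assumes "unital_topologized_magma X"
  shows "automorphism (HM0 X) HM_shift"
proof -
  define un where "un = (\<lambda>\<gamma>::real \<Rightarrow> 'a. \<lambda>t\<in>{0..<1}. \<gamma> (sqrt t))"
  let ?T = "topo X" and ?C = "carr (HM0 X)"
  have top: "topo (HM0 X) = subtopology (HM_topology ?T) {f \<in> HM_set ?T. f 0 = magma_unit X}"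
    by (simp add: HM0_def HM_def restrict_magma_def)
  have mulHM: "mul (HM0 X) f g = (\<lambda>t\<in>{0..<1}. mul X (f t) (g t))" for f g
    by (simp add: HM0_def HM_def restrict_magma_def)
  have ext: "f \<in> extensional {0..<1}" if "f \<in> ?C" for f
    using that by (auto simp: carr_HM0 HM_set_def PiE_iff)
  have C: "HM_shift f \<in> ?C" "un f \<in> ?C" if "f \<in> ?C" for f
    using that HM_reparametrize_closed[OF square_reparam] HM_reparametrize_closed[OF sqrt_reparam]
    by (auto simp: carr_HM0 HM_shift_def un_def)
  have inv: "un (HM_shift f) = f" "HM_shift (un f) = f" if "f \<in> ?C" for f
    using ext[OF that]
    by (auto simp: un_def HM_shift_def fun_eq_iff extensional_def power_less_one_iff)
  have bij: "bij_betw HM_shift ?C ?C"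
    by (rule bij_betw_byWitness[of _ un]) (use C inv in auto)
  have inv_un: "inv_into ?C HM_shift f = un f" if "f \<in> ?C" for f
    using that C inv bij by (metis bij_betw_imp_inj_on inv_into_f_eq)
  have unit: "magma_unit (HM0 X) = (\<lambda>t\<in>{0..<1}. magma_unit X)"
    using is_unit_of_HM0[OF assms] by (rule magma_unit_eqI)
  have unitC: "magma_unit (HM0 X) \<in> ?C"
    using is_unit_of_HM0[OF assms] unit by (simp add: is_unit_of_def)
  have closed: "mul (HM0 X) f g \<in> ?C" if fg: "f \<in> ?C" "g \<in> ?C" for f g
  proof -
    have "mul X x y \<in> carr X" if "x \<in> carr X" "y \<in> carr X" for x y
      using assms that by (simp add: unital_topologized_magma_def topologized_magma_def)
    then have "mul (HM0 X) f g \<in> HM_set ?T"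
      using fg unfolding mulHM carr_HM0 by (intro HM_set_pointwise) auto
    moreover have "mul (HM0 X) f g 0 = magma_unit X"
      using fg is_unit_of_magma_unit[OF assms] by (simp add: mulHM carr_HM0 is_unit_of_def)
    ultimately show ?thesis by (simp add: carr_HM0)
  qed
  have cont: "continuous_map (topo (HM0 X)) (topo (HM0 X)) HM_shift"
    "continuous_map (topo (HM0 X)) (topo (HM0 X)) un"
  proof -
    have *: "continuous_map (topo (HM0 X)) (topo (HM0 X)) h"
      if h: "continuous_map (HM_topology ?T) (HM_topology ?T) h" and hC: "h \<in> ?C \<rightarrow> ?C" for h
      using continuous_map_from_subtopology[OF h] hC
      by (simp add: top continuous_map_in_subtopology carr_HM0 Pi_iff)
    show "continuous_map (topo (HM0 X)) (topo (HM0 X)) HM_shift"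
      using continuous_map_HM_shift C(1) by (intro *) auto
    show "continuous_map (topo (HM0 X)) (topo (HM0 X)) un"
      unfolding un_def using continuous_map_HM_unshift C(2) by (intro *) (auto simp: un_def)
  qed
  have "continuous_hom (HM0 X) (HM0 X) HM_shift"
    unfolding continuous_hom_def unit mulHM using cont
    by (auto simp: HM_shift_def fun_eq_iff power_less_one_iff)
  moreover have "continuous_hom (HM0 X) (HM0 X) (inv_into ?C HM_shift)"
    unfolding continuous_hom_def
  proof (intro conjI ballI)
    show "continuous_map (topo (HM0 X)) (topo (HM0 X)) (inv_into ?C HM_shift)"
      using cont(2) inv_un by (metis continuous_map_eq)
    show "inv_into ?C HM_shift (magma_unit (HM0 X)) = magma_unit (HM0 X)"
      unfolding inv_un[OF unitC] by (auto simp: unit un_def fun_eq_iff)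
    show "inv_into ?C HM_shift (mul (HM0 X) f g)
        = mul (HM0 X) (inv_into ?C HM_shift f) (inv_into ?C HM_shift g)"
      if "f \<in> ?C" "g \<in> ?C" for f g
      using that unfolding inv_un[OF that(1)] inv_un[OF that(2)] inv_un[OF closed[OF that]]
      by (auto simp: mulHM un_def fun_eq_iff)
  qed
  ultimately show ?thesis using bij by (simp add: automorphism_def)
qed

end

theory Submission
  imports Defs
begin

text \<open>A step function \<open>\<gamma>\<close> with \<open>\<gamma> 0 = 1\<close> equals the unit on some \<open>[0, c)\<close> with \<open>c > 0\<close>, so
  \<open>\<alpha>\<^sup>k \<gamma> = (\<lambda>t. \<gamma> (t ^ 2 ^ k))\<close> equals the unit on \<open>[0, root (2 ^ k) c)\<close>, and
  \<open>root (2 ^ k) c\<close> tends to \<open>1\<close>. Thus every \<open>\<alpha>\<close>-orbit converges to the unit, that is, every element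
  of \<open>HM0 X\<close> is moved into any given neighbourhood of the unit by a power of \<open>\<alpha>\<close>.
  Since \<open>(1, n) (u, 0) (1, m) = (\<alpha>\<^sup>n u, n + m)\<close>, the countable set \<open>{1} \<times> \<int>\<close> witnesses duoseparability.
  A point \<open>x\<close> of \<open>X\<close> is represented by the function that jumps from the unit to \<open>x\<close> at \<open>1/2\<close>.\<close>

section \<open>Convergence in a topology given by a subbase\<close>

text \<open>The sets that contain \<open>f k\<close> eventually as soon as they contain
  \<open>l\<close> are closed under finite intersections and arbitrary unions, so testing the
  subbase suffices.\<close>

lemma limitin_topology_generated_by:
  assumes "l \<in> \<Union>\<S>" and "\<And>U. U \<in> \<S> \<Longrightarrow> l \<in> U \<Longrightarrow> eventually (\<lambda>k. f k \<in> U) F"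
  shows "limitin (topology_generated_by \<S>) f l F"
  unfolding limitin_def topology_generated_by_topspace
proof (intro conjI allI impI assms(1))
  fix W assume W: "openin (topology_generated_by \<S>) W \<and> l \<in> W"
  then have "generate_topology_on \<S> W" by (simp add: openin_topology_generated_by_iff)
  then have "l \<in> W \<longrightarrow> eventually (\<lambda>k. f k \<in> W) F"
  proof induction
    case (UN K)
    show ?case
    proof
      assume "l \<in> \<Union>K"
      then obtain V where "V \<in> K" "eventually (\<lambda>k. f k \<in> V) F" using UN by blast
      then show "eventually (\<lambda>k. f k \<in> \<Union>K) F" by (auto elim: eventually_mono)
    qed
  qed (auto simp: assms(2) eventually_conj)
  then show "eventually (\<lambda>k. f k \<in> W) F" using W by blast
qed

section \<open>Integer powers of a bijection and semidirect products with the integers\<close>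

lemma int_power_on_0 [simp]: "int_power_on C \<alpha> 0 y = y"
  by (simp add: int_power_on_def)

lemma int_power_on_closed:
  assumes "bij_betw \<alpha> C C" "y \<in> C"
  shows "int_power_on C \<alpha> n y \<in> C"
proof -
  have "(\<beta> ^^ k) y \<in> C" if "bij_betw \<beta> C C" for \<beta> k
    using that assms(2) by (induction k) (auto dest: bij_betw_apply)
  then show ?thesis
    using assms(1) bij_betw_inv_into[OF assms(1)] by (auto simp: int_power_on_def)
qed

lemma int_power_on_fixed:
  assumes "bij_betw \<alpha> C C" "y \<in> C" "\<alpha> y = y"
  shows "int_power_on C \<alpha> n y = y"
proof -
  have "inv_into C \<alpha> y = y" using assms by (metis bij_betw_inv_into_left)
  moreover have "(\<beta> ^^ k) y = y" if "\<beta> y = y" for \<beta> k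
    using that by (induction k) auto
  ultimately show ?thesis using assms(3) by (auto simp: int_power_on_def)
qed

lemma int_power_on_uminus_funpow:
  assumes "bij_betw \<alpha> C C" "y \<in> C"
  shows "int_power_on C \<alpha> (- int k) ((\<alpha> ^^ k) y) = y"
proof -
  have "(inv_into C \<alpha> ^^ k) ((\<alpha> ^^ k) y) = y"
  proof (induction k)
    case (Suc k)
    have "(\<alpha> ^^ k) y \<in> C"
      using int_power_on_closed[OF assms, of "int k"] by (simp add: int_power_on_def)
    then have "inv_into C \<alpha> (\<alpha> ((\<alpha> ^^ k) y)) = (\<alpha> ^^ k) y"
      by (rule bij_betw_inv_into_left[OF assms(1)])
    \<comment> \<open>The inverse powers are unfolded on the right and the powers of
      \<open>\<alpha>\<close> on the left, so that the innermost pair cancels.\<close>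
    then show ?case
      using Suc by (simp only: funpow_Suc_right[of k "inv_into C \<alpha>"] funpow.simps(2)[of k \<alpha>] o_apply)
  qed simp
  then show ?thesis by (auto simp: int_power_on_def)
qed

context
  fixes Y :: "'a topmagma" and \<alpha>
  assumes Y: "unital_topologized_magma Y" and \<alpha>: "automorphism Y \<alpha>"
begin

lemma carr_semidirect_int: "carr (semidirect_int Y \<alpha>) = carr Y \<times> UNIV"
  by (simp add: semidirect_int_def)

lemma mul_semidirect_int:
  "mul (semidirect_int Y \<alpha>) (x, n) (y, m) = (mul Y x (int_power_on (carr Y) \<alpha> n y), n + m)"
  by (simp add: semidirect_int_def)

lemma semidirect_int_closed:
  "p \<in> carr (semidirect_int Y \<alpha>) \<Longrightarrow> q \<in> carr (semidirect_int Y \<alpha>) \<Longrightarrow>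
     mul (semidirect_int Y \<alpha>) p q \<in> carr (semidirect_int Y \<alpha>)"
  using Y \<alpha> int_power_on_closed[of \<alpha> "carr Y"]
  by (auto simp: carr_semidirect_int mul_semidirect_int automorphism_def
      unital_topologized_magma_def topologized_magma_def)

lemma int_power_on_unit:
  "int_power_on (carr Y) \<alpha> n (magma_unit Y) = magma_unit Y"
  using \<alpha> is_unit_of_magma_unit[OF Y]
  by (intro int_power_on_fixed) (auto simp: automorphism_def continuous_hom_def is_unit_of_def)

lemma is_unit_of_semidirect_int: "is_unit_of (semidirect_int Y \<alpha>) (magma_unit Y, 0)"
  using is_unit_of_magma_unit[OF Y]
  by (auto simp: is_unit_of_def carr_semidirect_int mul_semidirect_int int_power_on_unit)

lemma unital_semidirect_int: "unital_topologized_magma (semidirect_int Y \<alpha>)"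
  using semidirect_int_closed is_unit_of_semidirect_int
  by (auto simp: unital_topologized_magma_def topologized_magma_def)

text \<open>Reduces duoseparability to the dynamics of \<open>\<alpha>\<close>: it is enough that
  every orbit converges to the unit.\<close>

lemma duoseparable_semidirect_int:
  assumes lim: "\<And>y. y \<in> carr Y \<Longrightarrow>
    limitin (topo Y) (\<lambda>k. (\<alpha> ^^ k) y) (magma_unit Y) sequentially"
  shows "duoseparable (semidirect_int Y \<alpha>)"
proof -
  let ?M = "semidirect_int Y \<alpha>" and ?e = "magma_unit Y"
  let ?S = "{?e} \<times> (UNIV :: int set)"
  have e: "?e \<in> carr Y" "\<And>y. y \<in> carr Y \<Longrightarrow> mul Y ?e y = y" "\<And>y. y \<in> carr Y \<Longrightarrow> mul Y y ?e = y"
    using is_unit_of_magma_unit[OF Y] by (auto simp: is_unit_of_def)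
  have bij: "bij_betw \<alpha> (carr Y) (carr Y)" using \<alpha> by (simp add: automorphism_def)
  have S: "?S \<subseteq> carr ?M" using e by (auto simp: carr_semidirect_int)
  have "set_mul ?M ?S (set_mul ?M U ?S) = carr ?M \<and> set_mul ?M (set_mul ?M ?S U) ?S = carr ?M"
    if U: "neighborhood (topo ?M) (magma_unit ?M) U" for U
  proof -
    have UM: "U \<subseteq> carr ?M" using U by (simp add: neighborhood_def)
    \<comment> \<open>The slice of \<open>U\<close> over the integer 0 is enough, because the
      factors from \<open>?S\<close> supply every integer coordinate.\<close>
    obtain V where V: "openin (topo Y) V" "?e \<in> V" "V \<times> {0} \<subseteq> U"
    proof -
      have "magma_unit ?M = (?e, 0)"
        using is_unit_of_semidirect_int by (rule magma_unit_eqI)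
      then obtain W where W: "openin (topo ?M) W" "(?e, 0) \<in> W" "W \<subseteq> U"
        using U by (auto simp: neighborhood_def)
      then have "\<exists>V I. openin (topo Y) V \<and> ?e \<in> V \<and> 0 \<in> I \<and> V \<times> I \<subseteq> W"
        by (simp add: semidirect_int_def openin_prod_topology_alt)
      then obtain V I where "openin (topo Y) V" "?e \<in> V" "0 \<in> I" "V \<times> I \<subseteq> W" by blast
      then show ?thesis using that[of V] W(3) by blast
    qed
    have "(y, i) \<in> set_mul ?M ?S (set_mul ?M U ?S) \<and> (y, i) \<in> set_mul ?M (set_mul ?M ?S U) ?S"
      if y: "y \<in> carr Y" for y i
    proof -
      have "eventually (\<lambda>k. (\<alpha> ^^ k) y \<in> V) sequentially"
        using lim[OF y] V by (simp add: limitin_def)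
      then obtain k where k: "(\<alpha> ^^ k) y \<in> V" by (auto simp: eventually_sequentially)
      define u where "u = (\<alpha> ^^ k) y"
      have u: "(u, 0) \<in> U" "u \<in> carr Y"
        using k V openin_subset[OF V(1)] by (auto simp: u_def)
      have yu: "int_power_on (carr Y) \<alpha> (- int k) u = y"
        unfolding u_def by (rule int_power_on_uminus_funpow[OF bij y])
      \<comment> \<open>\<open>?s\<close> undoes the \<open>k\<close> applications of
        \<open>\<alpha>\<close>, and \<open>?t\<close> corrects the integer coordinate to
        \<open>i\<close>. As powers of \<open>\<alpha>\<close> fix the unit, both bracketings give
        the same product without associativity.\<close>
      let ?s = "(?e, - int k)" and ?t = "(?e, i + int k)"
      have "mul ?M ?s (mul ?M (u, 0) ?t) = (y, i)" "mul ?M (mul ?M ?s (u, 0)) ?t = (y, i)"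
        using e u y by (simp_all add: mul_semidirect_int int_power_on_unit yu)
      moreover have "?s \<in> ?S" "?t \<in> ?S" by auto
      ultimately show ?thesis using u(1) unfolding set_mul_def mem_Collect_eq by metis
    qed
    moreover have "set_mul ?M A B \<subseteq> carr ?M" if "A \<subseteq> carr ?M" "B \<subseteq> carr ?M" for A B
      using that semidirect_int_closed unfolding set_mul_def by blast
    then have "set_mul ?M ?S (set_mul ?M U ?S) \<subseteq> carr ?M" "set_mul ?M (set_mul ?M ?S U) ?S \<subseteq> carr ?M"
      using S UM by meson+
    ultimately show ?thesis by (auto simp: carr_semidirect_int)
  qed
  then show ?thesis
    unfolding duoseparable_def using unital_semidirect_int S by blast
qed

end

section \<open>Convergence in the Hartman-Mycielski topology\<close>

lemma lmeasurable_HM_vimage: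
  assumes "f \<in> HM_set T" "0 \<le> a" "b \<le> 1"
  shows "{a..<b} - f -` U \<in> lmeasurable"
  using HM_set_vimage_borel[OF assms]
  by (intro bounded_set_imp_lmeasurable) (auto intro: bounded_subset[of "{a..<b}"])

text \<open>\<open>f k\<close> and \<open>g\<close> can differ only on \<open>[r k, 1)\<close>,
  whose measure \<open>1 - r k\<close> tends to 0; the values taken there are irrelevant.\<close>

lemma limitin_HM_topology:
  assumes f: "\<And>k. f k \<in> HM_set T" and g: "g \<in> HM_set T"
    and r: "r \<longlonglongrightarrow> 1" "\<And>k. 0 \<le> r k" "\<And>k. r k \<le> 1"
    and eq: "\<And>k t. 0 \<le> t \<Longrightarrow> t < r k \<Longrightarrow> f k t = g t"
  shows "limitin (HM_topology T) f g sequentially"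
  unfolding HM_topology_def
proof (rule limitin_topology_generated_by)
  show "g \<in> \<Union> {HM_nbh T U a b \<epsilon> | U a b \<epsilon>. openin T U \<and> 0 \<le> a \<and> a < b \<and> b \<le> 1 \<and> 0 < \<epsilon>}"
    unfolding topology_generated_by_topspace[symmetric] HM_topology_def[symmetric] using g by simp
next
  fix N assume "N \<in> {HM_nbh T U a b \<epsilon> | U a b \<epsilon>. openin T U \<and> 0 \<le> a \<and> a < b \<and> b \<le> 1 \<and> 0 < \<epsilon>}"
    and "g \<in> N"
  then obtain U a b \<epsilon> where N: "N = HM_nbh T U a b \<epsilon>" and ab: "0 \<le> a" "b \<le> 1"
    and m: "measure lebesgue ({a..<b} - g -` U) < \<epsilon>" by (auto simp: HM_nbh_def)
  \<comment> \<open>The strict inequality in \<open>g \<in> N\<close> leaves positive slack, and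
    \<open>1 - r k\<close> eventually drops below it.\<close>
  have "eventually (\<lambda>k. 1 - r k < \<epsilon> - measure lebesgue ({a..<b} - g -` U)) sequentially"
  proof -
    have "(\<lambda>k. 1 - r k) \<longlonglongrightarrow> 1 - 1" by (intro tendsto_intros r)
    then show ?thesis using m by (intro order_tendstoD(2)) auto
  qed
  then show "eventually (\<lambda>k. f k \<in> N) sequentially"
  proof (rule eventually_mono)
    fix k assume k: "1 - r k < \<epsilon> - measure lebesgue ({a..<b} - g -` U)"
    have lm: "{r k..<1} \<in> lmeasurable"
      by (intro bounded_set_imp_lmeasurable) auto
    have "{a..<b} - f k -` U \<subseteq> ({a..<b} - g -` U) \<union> {r k..<1}"
    proof
      fix t assume "t \<in> {a..<b} - f k -` U"
      then show "t \<in> ({a..<b} - g -` U) \<union> {r k..<1}"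
        using ab eq[of t k] by (cases "t < r k") auto
    qed
    then have "measure lebesgue ({a..<b} - f k -` U)
        \<le> measure lebesgue (({a..<b} - g -` U) \<union> {r k..<1})"
      using lmeasurable_HM_vimage[OF f ab] lmeasurable_HM_vimage[OF g ab] lm
      by (intro measure_mono_fmeasurable fmeasurable.Un) auto
    also have "\<dots> \<le> measure lebesgue ({a..<b} - g -` U) + measure lebesgue {r k..<1}"
      using lmeasurable_HM_vimage[OF g ab] by (intro measure_Un_le) auto
    also have "\<dots> < \<epsilon>" using k r(3)[of k] by simp
    finally show "f k \<in> N" using f by (simp add: N HM_nbh_def)
  qed
qed

section \<open>Orbits of the shift on \<open>HM0 X\<close>\<close>

lemma topo_HM0:
  "topo (HM0 X) = subtopology (HM_topology (topo X)) {f \<in> HM_set (topo X). f 0 = magma_unit X}"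
  by (simp add: HM0_def HM_def restrict_magma_def)

lemma mul_HM0: "mul (HM0 X) f g = (\<lambda>t\<in>{0..<1}. mul X (f t) (g t))"
  by (simp add: HM0_def HM_def restrict_magma_def)

lemma unital_HM0:
  assumes X: "unital_topologized_magma X"
  shows "unital_topologized_magma (HM0 X)"
proof -
  have "mul (HM0 X) f g \<in> carr (HM0 X)" if fg: "f \<in> carr (HM0 X)" "g \<in> carr (HM0 X)" for f g
  proof -
    have "mul (HM0 X) f g \<in> HM_set (topo X)"
      using fg X unfolding mul_HM0 carr_HM0
      by (intro HM_set_pointwise) (auto simp: unital_topologized_magma_def topologized_magma_def)
    then show ?thesis
      using fg is_unit_of_magma_unit[OF X] by (simp add: mul_HM0 carr_HM0 is_unit_of_def)
  qed
  then show ?thesis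
    using is_unit_of_HM0[OF X] by (auto simp: unital_topologized_magma_def topologized_magma_def)
qed

lemma funpow_HM_shift:
  "0 \<le> t \<Longrightarrow> t < 1 \<Longrightarrow> (HM_shift ^^ k) \<gamma> t = \<gamma> (t ^ 2 ^ k)"
  \<comment> \<open>Peeling off the outermost shift calls for the induction hypothesis at the square
    of \<open>t\<close>, hence \<open>t\<close> is generalized.\<close>
  by (induction k arbitrary: t) (auto simp: HM_shift_def power_less_one_iff power_mult[symmetric])

text \<open>The first cell of a partition for \<open>f\<close> is \<open>[0, p 1)\<close>, so
  \<open>c = p 1\<close> works.\<close>

lemma HM_set_constant_near_0:
  assumes "f \<in> HM_set T"
  obtains c where "0 < c" "c \<le> 1" "\<And>t. 0 \<le> t \<Longrightarrow> t < c \<Longrightarrow> f t = f 0"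
proof -
  obtain n p where p: "p 0 = 0" "p n = 1" "\<forall>i<n. p i < p (Suc i)"
    "\<forall>i<n. \<exists>c. \<forall>t\<in>{p i..<p (Suc i)}. f t = c"
    using assms unfolding HM_set_def by blast
  have n: "0 < n" using p(1,2) by (cases n) auto
  then have "0 < p 1" using p(1,3) by fastforce
  moreover have "p 1 \<le> 1" using partition_bounds(2)[of p n 0] p n by simp
  moreover have "f t = f 0" if "0 \<le> t" "t < p 1" for t
    using p(1,4) n that \<open>0 < p 1\<close> by (metis One_nat_def atLeastLessThan_iff order_refl)
  ultimately show ?thesis by (rule that)
qed

lemma HM_shift_orbit_tendsto_unit:
  assumes X: "unital_topologized_magma X" and y: "y \<in> carr (HM0 X)"
  shows "limitin (topo (HM0 X)) (\<lambda>k. (HM_shift ^^ k) y) (magma_unit (HM0 X)) sequentially"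
proof -
  let ?u = "\<lambda>t\<in>{0..<1}. magma_unit X"
  have unit: "magma_unit (HM0 X) = ?u" using is_unit_of_HM0[OF X] by (rule magma_unit_eqI)
  have u: "?u \<in> carr (HM0 X)" using is_unit_of_HM0[OF X] by (simp add: is_unit_of_def)
  have orbit: "(HM_shift ^^ k) y \<in> carr (HM0 X)" for k
    using int_power_on_closed[of HM_shift "carr (HM0 X)" y "int k"] automorphism_HM_shift[OF X] y
    by (simp add: automorphism_def int_power_on_def)
  obtain c where c: "0 < c" "c \<le> 1" "\<And>t. 0 \<le> t \<Longrightarrow> t < c \<Longrightarrow> y t = magma_unit X"
    using y HM_set_constant_near_0[of y "topo X"] by (auto simp: carr_HM0)
  define r where "r = (\<lambda>k. root (2 ^ k) c)"
  have "limitin (HM_topology (topo X)) (\<lambda>k. (HM_shift ^^ k) y) ?u sequentially"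
  proof (rule limitin_HM_topology)
    \<comment> \<open>The roots \<open>root n c\<close> of the positive constant \<open>c\<close>
      tend to 1; \<open>r\<close> is the subsequence along \<open>n = 2 ^ k\<close>.\<close>
    have "strict_mono (\<lambda>k. 2 ^ k :: nat)" by (simp add: strict_mono_def)
    then show "r \<longlonglongrightarrow> 1"
      using LIMSEQ_subseq_LIMSEQ[OF LIMSEQ_root_const[OF c(1)]] by (simp add: r_def o_def)
    show "0 \<le> r k" "r k \<le> 1" for k using c by (simp_all add: r_def real_root_le_1_iff)
    show "(HM_shift ^^ k) y t = ?u t" if t: "0 \<le> t" "t < r k" for k t
    proof -
      have "t < 1" using t \<open>r k \<le> 1\<close> by linarith
      have "t ^ 2 ^ k < r k ^ 2 ^ k" using t by (intro power_strict_mono) auto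
      then have "t ^ 2 ^ k < c" using c(1) by (simp add: r_def)
      then show ?thesis using t \<open>t < 1\<close> c(3) by (simp add: funpow_HM_shift)
    qed
  qed (use orbit u in \<open>auto simp: carr_HM0\<close>)
  then show ?thesis
    using orbit u by (auto simp: topo_HM0 limitin_subtopology unit carr_HM0)
qed

section \<open>The embedding of \<open>X\<close>\<close>

definition jump :: "'a \<Rightarrow> 'a \<Rightarrow> real \<Rightarrow> 'a" where
  "jump e x = (\<lambda>t\<in>{0..<1}. if t < 1/2 then e else x)"

lemma jump_in_HM_set:
  assumes "e \<in> topspace T" "x \<in> topspace T"
  shows "jump e x \<in> HM_set T"
  \<comment> \<open>If \<open>x < 1/2 \<le> y\<close>, the breakpoint \<open>1/2\<close> lies in
    \<open>{x<..y}\<close>; this is the only case in which the two values could differ.\<close>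
  by (rule HM_setI[of _ _ "{0, 1/2, 1}"]) (use assms in \<open>auto simp: jump_def disjoint_iff dest: spec[of _ "1/2"]\<close>)

lemma inj_jump: "inj (jump e)"
proof (rule injI)
  fix x y :: 'a assume "jump e x = jump e y"
  then have "jump e x (1/2) = jump e y (1/2)" by (rule arg_cong)
  then show "x = y" by (simp add: jump_def)
qed

lemma continuous_map_jump:
  assumes e: "e \<in> topspace T"
  shows "continuous_map T (HM_topology T) (jump e)"
  unfolding HM_topology_def
proof (rule continuous_on_generated_topo)
  fix N assume "N \<in> {HM_nbh T U a b \<epsilon> | U a b \<epsilon>. openin T U \<and> 0 \<le> a \<and> a < b \<and> b \<le> 1 \<and> 0 < \<epsilon>}"
  then obtain U a b \<epsilon> where N: "N = HM_nbh T U a b \<epsilon>" and U: "openin T U"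
    and ab: "0 \<le> a" "b \<le> 1" by blast
  define J where "J = jump e -` N \<inter> topspace T"
  \<comment> \<open>Whether \<open>jump e x\<close> lies in \<open>N\<close> depends on \<open>x\<close> only through \<open>x \<in> U\<close>, monotonically.\<close>
  have mono: "y \<in> J" if "x \<in> J" "y \<in> topspace T" "x \<in> U \<Longrightarrow> y \<in> U" for x y
  proof -
    have xy: "jump e x \<in> HM_set T" "jump e y \<in> HM_set T"
      using that e by (auto simp: J_def intro!: jump_in_HM_set)
    have "{a..<b} - jump e y -` U \<subseteq> {a..<b} - jump e x -` U"
      using that(3) ab by (auto simp: jump_def split: if_splits)
    then have "measure lebesgue ({a..<b} - jump e y -` U) \<le> measure lebesgue ({a..<b} - jump e x -` U)"
      using lmeasurable_HM_vimage[OF xy(1) ab] lmeasurable_HM_vimage[OF xy(2) ab]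
      by (intro measure_mono_fmeasurable) auto
    then show ?thesis using that(1,2) xy by (auto simp: J_def N HM_nbh_def)
  qed
  have "J \<subseteq> topspace T" "U \<subseteq> topspace T" using openin_subset[OF U] by (auto simp: J_def)
  \<comment> \<open>If \<open>J\<close> has a point outside \<open>U\<close>, it is the whole space
    by \<open>mono\<close>; otherwise \<open>J\<close> lies in \<open>U\<close>, and any point of
    \<open>J\<close> forces all of \<open>U\<close> into \<open>J\<close>.\<close>
  then have "J = {} \<or> J = U \<or> J = topspace T" using mono by blast
  then show "openin T (jump e -` N \<inter> topspace T)"
    unfolding J_def[symmetric] using U by auto
next
  show "jump e ` topspace T \<subseteq>
      \<Union> {HM_nbh T U a b \<epsilon> | U a b \<epsilon>. openin T U \<and> 0 \<le> a \<and> a < b \<and> b \<le> 1 \<and> 0 < \<epsilon>}"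
    unfolding topology_generated_by_topspace[symmetric] HM_topology_def[symmetric]
    using e jump_in_HM_set by fastforce
qed

text \<open>On \<open>[1/2, 1)\<close> the jump function is constantly \<open>x\<close>, so the
  exceptional set is empty or has measure exactly \<open>1/2\<close>, which the strict bound
  excludes. Hence every open \<open>U\<close> is recovered from a subbasic set, which makes the
  inverse of the embedding continuous.\<close>

lemma jump_in_HM_nbh_iff:
  assumes "e \<in> topspace T" "x \<in> topspace T"
  shows "jump e x \<in> HM_nbh T U (1/2) 1 (1/2) \<longleftrightarrow> x \<in> U"
proof -
  have "{1/2..<1} - jump e x -` U = (if x \<in> U then {} else {1/2..<1})"
    by (auto simp: jump_def)
  then show ?thesis using jump_in_HM_set[OF assms] by (auto simp: HM_nbh_def)
qed

lemma contains_copy_semidirect_HM0: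
  assumes X: "unital_topologized_magma X"
  shows "contains_copy_of (semidirect_int (HM0 X) HM_shift) X"
proof -
  let ?M = "semidirect_int (HM0 X) HM_shift" and ?T = "topo X"
  define e where "e = magma_unit X"
  define f where "f x = (jump e x, 0 :: int)" for x
  let ?A = "f ` carr X"
  let ?R = "restrict_magma ?M ?A"
  have e: "e \<in> carr X" "\<And>x. x \<in> carr X \<Longrightarrow> mul X e x = x" "\<And>x. x \<in> carr X \<Longrightarrow> mul X x e = x"
    using is_unit_of_magma_unit[OF X] by (auto simp: is_unit_of_def e_def)
  have closed: "mul X x y \<in> carr X" if "x \<in> carr X" "y \<in> carr X" for x y
    using X that by (simp add: unital_topologized_magma_def topologized_magma_def)
  have jumpC: "jump e x \<in> carr (HM0 X)" if "x \<in> carr X" for x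
    using jump_in_HM_set[OF e(1) that] by (simp add: carr_HM0 e_def jump_def)
  have topM: "topo ?M = prod_topology (topo (HM0 X)) (discrete_topology UNIV)"
    by (simp add: semidirect_int_def)
  \<comment> \<open>At the integer 0 the twist is the identity, so the product is pointwise:
    \<open>e\<close> times \<open>e\<close> is \<open>e\<close> before \<open>1/2\<close>, and the
    product of \<open>x\<close> and \<open>y\<close> stands from there on.\<close>
  have hom: "mul ?M (f x) (f y) = f (mul X x y)" if "x \<in> carr X" "y \<in> carr X" for x y
    using e that by (auto simp: f_def mul_HM0 jump_def fun_eq_iff semidirect_int_def)
  have A: "?A \<subseteq> carr ?M" using jumpC by (auto simp: topM f_def)
  have sub: "submagma ?A ?M" using A hom closed by (auto simp: submagma_def)
  have carrR: "carr ?R = ?A" using A by (auto simp: restrict_magma_def)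
  have mulR: "mul ?R = mul ?M" by (simp add: restrict_magma_def)
  have unitR: "is_unit_of ?R (f e)"
    unfolding is_unit_of_def carrR mulR using e hom by auto
  have "unital_topologized_magma ?R"
    unfolding unital_topologized_magma_def topologized_magma_def
  proof
    show "\<forall>p\<in>carr ?R. \<forall>q\<in>carr ?R. mul ?R p q \<in> carr ?R"
      using sub unfolding carrR mulR submagma_def by blast
    show "\<exists>p. is_unit_of ?R p" using unitR by (rule exI)
  qed
  moreover have "topological_isomorphism X ?R f"
  proof -
    have inj: "inj_on f (carr X)"
      using inj_jump[of e] by (auto simp: f_def inj_on_def inj_def)
    have "continuous_map ?T (topo (HM0 X)) (jump e)"
      using continuous_map_jump[OF e(1)] jumpC
      by (auto simp: topo_HM0 continuous_map_in_subtopology carr_HM0)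
    then have "continuous_map ?T (topo ?M) f"
      unfolding f_def topM by (simp add: continuous_map_pairedI)
    then have "continuous_map ?T (topo ?R) f"
      by (auto simp: restrict_magma_def continuous_map_in_subtopology)
    moreover have "continuous_map (topo ?R) ?T (inv_into (carr X) f)"
      unfolding continuous_map_def carrR
    proof (intro conjI allI impI)
      show "inv_into (carr X) f \<in> ?A \<rightarrow> carr X" by (auto simp: inj)
      fix U assume U: "openin ?T U"
      define N where "N = HM_nbh ?T U (1/2) 1 (1/2)"
      have "openin (HM_topology ?T) N"
        unfolding HM_topology_def N_def
        by (rule topology_generated_by_Basis) (use U in \<open>auto intro!: exI\<close>)
      then have "openin (topo (HM0 X)) (N \<inter> carr (HM0 X))"
        using openin_subtopology_Int by (simp only: carr_HM0) (simp only: topo_HM0)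
      then have "openin (topo ?M) ((N \<inter> carr (HM0 X)) \<times> UNIV)"
        by (simp add: topM openin_prod_Times_iff)
      then have "openin (topo ?R) ((N \<inter> carr (HM0 X)) \<times> UNIV \<inter> ?A)"
        by (simp add: restrict_magma_def openin_subtopology_Int)
      \<comment> \<open>The open set cuts out of the copy exactly the image of \<open>U\<close>; the
        integer coordinate may stay free since the copy lies over 0.\<close>
      moreover have "(N \<inter> carr (HM0 X)) \<times> UNIV \<inter> ?A = {p \<in> ?A. inv_into (carr X) f p \<in> U}"
      proof -
        have "f x \<in> (N \<inter> carr (HM0 X)) \<times> UNIV \<longleftrightarrow> inv_into (carr X) f (f x) \<in> U"
          if "x \<in> carr X" for x
          using jump_in_HM_nbh_iff[OF e(1) that] jumpC[OF that]
          unfolding inv_into_f_f[OF inj that] by (simp add: f_def N_def)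
        then have "p \<in> (N \<inter> carr (HM0 X)) \<times> UNIV \<longleftrightarrow> inv_into (carr X) f p \<in> U"
          if "p \<in> ?A" for p
          using that unfolding image_iff by metis
        then show ?thesis by (intro set_eqI)
            (simp only: Int_iff mem_Collect_eq conj_commute cong: conj_cong)
      qed
      ultimately show "openin (topo ?R) {p \<in> ?A. inv_into (carr X) f p \<in> U}" by simp
    qed
    ultimately show ?thesis
      unfolding topological_isomorphism_def continuous_hom_def carrR mulR
        magma_unit_eqI[OF unitR] e_def[symmetric]
      using inj hom by (auto simp: bij_betw_def)
  qed
  ultimately show ?thesis unfolding contains_copy_of_def using sub by blast
qed

theorem theorem2:
  fixes X :: "'a topmagma"
  assumes "unital_topologized_magma X"
  shows "unital_topologized_magma (semidirect_int (HM0 X) HM_shift) \<and>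
         duoseparable (semidirect_int (HM0 X) HM_shift) \<and>
         contains_copy_of (semidirect_int (HM0 X) HM_shift) X"
  using unital_semidirect_int[OF unital_HM0 automorphism_HM_shift]
    duoseparable_semidirect_int[OF unital_HM0 automorphism_HM_shift HM_shift_orbit_tendsto_unit]
    contains_copy_semidirect_HM0 assms
  by blast

end
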